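(* Let $p$ be a prime, $s\in\mathbb{N}$ with $s\ge1$, $\mathcal{A}=(\mathbb{Z}/p\mathbb{Z})^s$, $D\ge1$ and $\mathbb{M}=\mathbb{Z}^D$. If $\Phi:\mathcal{A}^{\mathbb{M}}\to\mathcal{A}^{\mathbb{M}}$ is a bipartite linear cellular automaton, then $\Phi$ is dispersive.
   Context: For $v\in\mathbb{M}$, $\sigma^v$ is the shift $\sigma^v(\mathbf{a})_m=a_{m-v}$ on $\mathcal{A}^{\mathbb{M}}$. A linear cellular automaton (LCA) is a map $\Phi=\sum_{f\in\mathbb{F}}\varphi_f\,\sigma^f$ with $\mathbb{F}\subset\mathbb{M}$ finite, $\#\mathbb{F}\ge 2$, and integer coefficients $\varphi_f$ that are nonzero modulo $p$. Write $1=\sigma^0$ and $|x|=|x_1|+\cdots+|x_D|$. For $\Gamma=\sum_{g\in\mathbb{G}}\gamma_g\sigma^g$ with $\mathbb{G}\subset\mathbb{M}$ finite nonempty (a single term is allowed) and coefficients $\gamma_g$ nonzero mod $p$: $\mathrm{diam}[\Gamma]=\max\{|g-h| : g,h\in\mathbb{G}\}$, $\mathrm{centre}(\Gamma)=\frac1{\#\mathbb{G}}\sum_{g\in\mathbb{G}}g\in\mathbb{R}^D$, and $\Gamma$ is centred if $|\mathrm{centre}(\Gamma)|<1$. Let $K_p=\min\left\{\frac12,\ \frac{4p-7}{4p+4}\right\}$. An LCA $\Phi$ is bipartite if $\Phi=1+\Gamma\circ\sigma^f$ for some $f\in\mathbb{M}$ and some centred $\Gamma=\sum_{g\in\mathbb{G}}\gamma_g\sigma^g$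 (with $\mathbb{G}\subset\mathbb{M}$ finite nonempty, a single term being allowed, and integer coefficients $\gamma_g$ nonzero mod $p$) with $\mathrm{diam}[\Gamma]\le K_p\cdot|f|$. A character of $\mathcal{A}^{\mathbb{M}}$ is a continuous homomorphism into the circle group; each has the form $\boldsymbol\chi(\mathbf{a})=\prod_{k\in\mathbb{K}}\chi_k(a_k)$ with $\mathbb{K}\subset\mathbb{M}$ finite (its support) and each $\chi_k$ a nontrivial character of $\mathcal{A}$. For $S>0$, two characters with supports $\mathbb{K},\mathbb{X}$ are $S$-separated if $|k-x|\ge S$ for all $k\in\mathbb{K}$, $x\in\mathbb{X}$. For a nontrivial character $\boldsymbol\chi$, $\mathrm{rank}_S(\boldsymbol\chi)$ is the maximal $R$ such that $\boldsymbol\chi=\boldsymbol\chi_1\cdots\boldsymbol\chi_R$ for some mutually $S$-separated nontrivial characters $\boldsymbol\chi_i$; for the trivial character put $\mathrm{rank}_S=0$. $\Phi$ is dispersive if for every $S>0$ and every nontrivial character $\boldsymbol\chi$ there is $\mathbb{J}\subset\mathbb{N}$ of Cesàro density one (i.e. $\lim_{N\to\infty}\frac1N\#(\mathbb{J}\cap[0,N))=1$) such that $\mathrm{rank}_S(\boldsymbol\chi\circ\Phi^j)\to\infty$ as $j\to\infty$ in $\mathbb{J}$. *)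

theory Defs
  imports "HOL-Analysis.Analysis" "HOL-Library.Function_Algebras"
    "HOL-Number_Theory.Cong" "Berlekamp_Zassenhaus.Finite_Field"
begin

text \<open>
  The prime is \<open>p = CARD('p)\<close> (the class \<open>prime_card\<close> says that it is prime), and
  \<open>'p mod_ring\<close> is the field of integers modulo \<open>p\<close>. The dimensions are \<open>s = CARD('s)\<close> and
  \<open>D = CARD('d)\<close>, so the alphabet is \<open>('p mod_ring) ^ 's\<close> and the lattice is \<open>int ^ 'd\<close>.
  Configurations are added pointwise (\<^theory>\<open>HOL-Library.Function_Algebras\<close>).
\<close>

type_synonym ('p, 's) alphabet = "('p mod_ring) ^ 's"
type_synonym ('p, 's, 'd) config = "int ^ 'd \<Rightarrow> ('p, 's) alphabet"

definition l1 :: "('a::ordered_ab_group_add_abs) ^ 'd \<Rightarrow> 'a" where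
  "l1 x = (\<Sum>i\<in>UNIV. \<bar>x $ i\<bar>)"


subsection \<open>Linear cellular automata\<close>

definition shift :: "int ^ 'd \<Rightarrow> ('p, 's::finite, 'd::finite) config \<Rightarrow> ('p, 's, 'd) config" where
  "shift v a = (\<lambda>m. a (m - v))"

definition shift_sum ::
  "(int ^ 'd) set \<Rightarrow> (int ^ 'd \<Rightarrow> int)
    \<Rightarrow> ('p::prime_card, 's::finite, 'd::finite) config \<Rightarrow> ('p, 's, 'd) config" where
  "shift_sum F \<phi> a = (\<lambda>m. \<Sum>f\<in>F. of_int (\<phi> f) *s shift f a m)"

definition linear_CA ::
  "(('p::prime_card, 's::finite, 'd::finite) config \<Rightarrow> ('p, 's, 'd) config) \<Rightarrow> bool" where
  "linear_CA \<Phi> \<longleftrightarrow> (\<exists>F \<phi>. finite F \<and> card F \<ge> 2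
     \<and> (\<forall>f\<in>F. \<not> [\<phi> f = 0] (mod int CARD('p))) \<and> \<Phi> = shift_sum F \<phi>)"

text \<open>Diameter and centre depend only on the set of shifts occurring in a sum of shifts.\<close>

definition diam :: "(int ^ 'd) set \<Rightarrow> int" where
  "diam G = Max {l1 (g - h) | g h. g \<in> G \<and> h \<in> G}"

definition centre :: "(int ^ 'd) set \<Rightarrow> real ^ 'd" where
  "centre G = (1 / real (card G)) *\<^sub>R (\<Sum>g\<in>G. \<chi> i. real_of_int (g $ i))"

definition centred :: "(int ^ 'd) set \<Rightarrow> bool" where
  "centred G \<longleftrightarrow> l1 (centre G) < 1"

definition K :: "nat \<Rightarrow> real" where
  "K p = min (1 / 2) ((4 * real p - 7) / (4 * real p + 4))"

definition bipartite ::
  "(('p::prime_card, 's::finite, 'd::finite) config \<Rightarrow> ('p, 's, 'd) config) \<Rightarrow> bool" where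
  "bipartite \<Phi> \<longleftrightarrow> linear_CA \<Phi> \<and> (\<exists>f G \<gamma>. finite G \<and> G \<noteq> {}
     \<and> (\<forall>g\<in>G. \<not> [\<gamma> g = 0] (mod int CARD('p)))
     \<and> centred G \<and> real_of_int (diam G) \<le> K CARD('p) * real_of_int (l1 f)
     \<and> \<Phi> = (\<lambda>a. a + shift_sum G \<gamma> (shift f a)))"


subsection \<open>Characters\<close>

definition circle_hom :: "('g::plus \<Rightarrow> complex) \<Rightarrow> bool" where
  "circle_hom \<psi> \<longleftrightarrow> (\<forall>x. \<psi> x \<in> sphere 0 1) \<and> (\<forall>x y. \<psi> (x + y) = \<psi> x * \<psi> y)"

definition nontrivial :: "('g \<Rightarrow> complex) \<Rightarrow> bool" where
  "nontrivial \<psi> \<longleftrightarrow> \<psi> \<noteq> (\<lambda>_. 1)"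

text \<open>Configurations carry the product of the discrete topologies on the alphabet; on the finite
  discrete alphabet itself every homomorphism into the circle is a character.\<close>

definition config_topology :: "('p, 's::finite, 'd::finite) config topology" where
  "config_topology = product_topology (\<lambda>_. discrete_topology UNIV) UNIV"

definition character :: "(('p::prime_card, 's::finite, 'd::finite) config \<Rightarrow> complex) \<Rightarrow> bool" where
  "character \<psi> \<longleftrightarrow> circle_hom \<psi> \<and> continuous_map config_topology euclidean \<psi>"

definition has_support ::
  "(('p::prime_card, 's::finite, 'd::finite) config \<Rightarrow> complex) \<Rightarrow> (int ^ 'd) set \<Rightarrow> bool" where
  "has_support \<psi> A \<longleftrightarrow> finite A \<and>
     (\<exists>c. (\<forall>k\<in>A. circle_hom (c k) \<and> nontrivial (c k)) \<and> \<psi> = (\<lambda>a. \<Prod>k\<in>A. c k (a k)))"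

text \<open>Every character has exactly one support: see \<open>ex1_support\<close> below.\<close>

definition support :: "(('p::prime_card, 's::finite, 'd::finite) config \<Rightarrow> complex) \<Rightarrow> (int ^ 'd) set" where
  "support \<psi> = (THE A. has_support \<psi> A)"

definition separated ::
  "real \<Rightarrow> (('p::prime_card, 's::finite, 'd::finite) config \<Rightarrow> complex)
    \<Rightarrow> (('p, 's, 'd) config \<Rightarrow> complex) \<Rightarrow> bool" where
  "separated S \<psi> \<xi> \<longleftrightarrow> (\<forall>k\<in>support \<psi>. \<forall>x\<in>support \<xi>. real_of_int (l1 (k - x)) \<ge> S)"

text \<open>For \<open>S > 0\<close> and a nontrivial character the set below is finite and contains \<open>1\<close>: separated
  nontrivial characters have disjoint nonempty supports.\<close>

definition rank :: "real \<Rightarrow> (('p::prime_card, 's::finite, 'd::finite) config \<Rightarrow> complex) \<Rightarrow> nat" where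
  "rank S \<psi> = (if nontrivial \<psi> then
     Max {R. \<exists>\<xi> :: nat \<Rightarrow> ('p, 's, 'd) config \<Rightarrow> complex.
       (\<forall>i<R. character (\<xi> i) \<and> nontrivial (\<xi> i))
       \<and> (\<forall>i<R. \<forall>j<R. i \<noteq> j \<longrightarrow> separated S (\<xi> i) (\<xi> j))
       \<and> \<psi> = (\<lambda>a. \<Prod>i<R. \<xi> i a)}
     else 0)"


subsection \<open>Dispersion\<close>

definition density_one :: "nat set \<Rightarrow> bool" where
  "density_one J \<longleftrightarrow> (\<lambda>N. real (card (J \<inter> {0..<N})) / real N) \<longlonglongrightarrow> 1"

definition dispersive ::
  "(('p::prime_card, 's::finite, 'd::finite) config \<Rightarrow> ('p, 's, 'd) config) \<Rightarrow> bool" where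
  "dispersive \<Phi> \<longleftrightarrow> (\<forall>S>0. \<forall>\<psi>. character \<psi> \<and> nontrivial \<psi> \<longrightarrow>
     (\<exists>J. density_one J \<and>
       filterlim (\<lambda>j. rank S (\<psi> \<circ> (\<Phi> ^^ j))) at_top (inf sequentially (principal J))))"


subsection \<open>Existence and uniqueness of supports\<close>

lemma circle_hom_zero:
  fixes \<psi> :: "'g::monoid_add \<Rightarrow> complex"
  assumes "circle_hom \<psi>"
  shows "\<psi> 0 = 1"
proof -
  have "\<psi> 0 * \<psi> 0 = \<psi> 0" using assms unfolding circle_hom_def by (metis add_0)
  moreover have "norm (\<psi> 0) = 1" using assms by (simp add: circle_hom_def)
  ultimately show ?thesis by force
qed

lemma circle_hom_funsum:
  fixes \<psi> :: "'g::comm_monoid_add \<Rightarrow> complex"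
  assumes "circle_hom \<psi>" "finite A"
  shows "\<psi> (\<Sum>k\<in>A. f k) = (\<Prod>k\<in>A. \<psi> (f k))"
  using assms(2)
proof (induction A rule: finite_induct)
  case empty
  then show ?case using circle_hom_zero[OF assms(1)] by simp
next
  case (insert x A)
  then show ?case using assms(1) by (simp add: circle_hom_def)
qed

definition single ::
  "int ^ 'd \<Rightarrow> ('p::prime_card, 's::finite) alphabet \<Rightarrow> ('p, 's, 'd::finite) config" where
  "single k x = (\<lambda>m. if m = k then x else 0)"

lemma has_support_single:
  assumes "finite A" and c: "\<forall>k\<in>A. circle_hom (c k)"
    and \<psi>: "\<psi> = (\<lambda>a. \<Prod>k\<in>A. c k (a k))"
  shows "\<psi> (single k x) = (if k \<in> A then c k x else 1)"
proof -
  have "\<psi> (single k x) = (\<Prod>j\<in>A. if j = k then c k x else 1)"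
    unfolding \<psi> single_def by (rule prod.cong) (use c circle_hom_zero in auto)
  then show ?thesis using assms(1) by simp
qed

lemma has_support_unique:
  assumes "has_support \<psi> A"
  shows "A = {k. nontrivial (\<lambda>x. \<psi> (single k x))}"
proof -
  obtain c where c: "finite A" "\<forall>k\<in>A. circle_hom (c k) \<and> nontrivial (c k)"
    "\<psi> = (\<lambda>a. \<Prod>k\<in>A. c k (a k))"
    using assms unfolding has_support_def by blast
  have "(\<lambda>x. \<psi> (single k x)) = (if k \<in> A then c k else (\<lambda>_. 1))" for k
    using has_support_single[OF c(1) _ c(3)] c(2) by auto
  then show ?thesis using c(2) by (auto simp: nontrivial_def)
qed

lemma root_of_unity_eq_1:
  fixes z :: complex
  assumes "z ^ n = 1" "n > 0" "\<And>i. Re (z ^ i) > 0"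
  shows "z = 1"
proof (rule ccontr)
  assume "z \<noteq> 1"
  then have "(\<Sum>i<n. z ^ i) = 0" using assms(1) by (simp add: geometric_sum)
  moreover have "Re (\<Sum>i<n. z ^ i) > 0"
    unfolding Re_sum by (rule sum_pos) (use assms in auto)
  ultimately show False by simp
qed

lemma character_local:
  fixes \<psi> :: "('p::prime_card, 's::finite, 'd::finite) config \<Rightarrow> complex"
  assumes "character \<psi>"
  obtains A where "finite A" "\<And>a. (\<forall>k\<in>A. a k = 0) \<Longrightarrow> \<psi> a = 1"
proof -
  have h: "circle_hom \<psi>" using assms by (simp add: character_def)
  have "openin euclidean {z :: complex. 0 < Re z}"
    using open_halfspace_Re_gt[of 0] open_openin by metis
  then have "openin config_topology {a \<in> topspace config_topology. \<psi> a \<in> {z. 0 < Re z}}"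
    using assms unfolding character_def by (blast intro: openin_continuous_map_preimage)
  then have "openin (product_topology (\<lambda>_. discrete_topology UNIV) UNIV) {a. Re (\<psi> a) > 0}"
    by (simp add: config_topology_def)
  moreover have "(0 :: ('p, 's, 'd) config) \<in> {a. Re (\<psi> a) > 0}"
    using circle_hom_zero[OF h] by simp
  ultimately obtain X :: "int ^ 'd \<Rightarrow> ('p, 's) alphabet set" where X: "finite {k. X k \<noteq> UNIV}"
    "0 \<in> PiE UNIV X" "PiE UNIV X \<subseteq> {a. Re (\<psi> a) > 0}"
    unfolding openin_product_topology_alt
    by (auto dest!: bspec[where x = "0 :: ('p, 's, 'd) config"])
  show ?thesis
  proof
    show "finite {k. X k \<noteq> UNIV}" by fact
    fix a :: "('p, 's, 'd) config"
    assume a: "\<forall>k\<in>{k. X k \<noteq> UNIV}. a k = 0"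
    define m where "m n = (\<Sum>i<n. a)" for n :: nat
    have m_val: "m n k = of_nat n *s a k" for n k
      unfolding m_def by (induction n) (auto simp: vec_eq_iff algebra_simps)
    have \<psi>m: "\<psi> (m n) = \<psi> a ^ n" for n
      unfolding m_def using circle_hom_funsum[OF h, of "{..<n}" "\<lambda>_. a"] by simp
    have "of_nat CARD('p) = (0 :: 'p mod_ring)"
      by simp
    then have "m CARD('p) = 0" by (auto simp: fun_eq_iff m_val)
    then have 1: "\<psi> a ^ CARD('p) = 1" using \<psi>m circle_hom_zero[OF h] by metis
    have "m n k \<in> X k" for n k
      using X(2) a by (cases "X k = UNIV") (auto simp: m_val PiE_def Pi_def)
    then have "m n \<in> PiE UNIV X" for n by auto
    then have 2: "Re (\<psi> a ^ n) > 0" for n using X(3) \<psi>m by (metis mem_Collect_eq subsetD)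
    show "\<psi> a = 1" using root_of_unity_eq_1[OF 1 _ 2] by simp
  qed
qed

lemma ex1_support:
  fixes \<psi> :: "('p::prime_card, 's::finite, 'd::finite) config \<Rightarrow> complex"
  assumes "character \<psi>"
  shows "\<exists>!A. has_support \<psi> A"
proof -
  have h: "circle_hom \<psi>" using assms by (simp add: character_def)
  obtain A where A: "finite A" "\<And>a. (\<forall>k\<in>A. a k = 0) \<Longrightarrow> \<psi> a = 1"
    using character_local[OF assms] by blast
  define B where "B = {k\<in>A. nontrivial (\<lambda>x. \<psi> (single k x))}"
  have "\<psi> a = (\<Prod>k\<in>B. \<psi> (single k (a k)))" for a
  proof -
    define r where "r = a - (\<Sum>k\<in>A. single k (a k))"
    have s: "(\<Sum>k\<in>A'. single k (a k)) m = (if m \<in> A' then a m else 0)" if "finite A'" for m A'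
      using that by (induction A' rule: finite_induct) (auto simp: single_def)
    have "\<psi> r = 1" by (rule A(2)) (auto simp: r_def s[OF A(1)])
    moreover have "\<psi> a = \<psi> (r + (\<Sum>k\<in>A. single k (a k)))" by (simp add: r_def)
    ultimately have "\<psi> a = \<psi> (\<Sum>k\<in>A. single k (a k))"
      using h unfolding circle_hom_def by (metis mult_1)
    also have "\<dots> = (\<Prod>k\<in>A. \<psi> (single k (a k)))" by (rule circle_hom_funsum[OF h A(1)])
    also have "\<dots> = (\<Prod>k\<in>B. \<psi> (single k (a k)))"
      by (rule prod.mono_neutral_right) (use A(1) in \<open>auto simp: B_def nontrivial_def fun_eq_iff\<close>)
    finally show ?thesis .
  qed
  moreover have "circle_hom (\<lambda>x. \<psi> (single k x))" for k
  proof -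
    have "single k (x + y) = single k x + single k y" for x y :: "('p, 's) alphabet"
      by (auto simp: single_def)
    then show ?thesis using h by (simp add: circle_hom_def)
  qed
  moreover have "finite B" "\<forall>k\<in>B. nontrivial (\<lambda>x. \<psi> (single k x))"
    using A(1) by (simp_all add: B_def)
  ultimately have "has_support \<psi> B"
    unfolding has_support_def by (intro conjI exI[of _ "\<lambda>k x. \<psi> (single k x)"]) blast+
  then show ?thesis using has_support_unique by metis
qed

end

theory Submission
  imports Defs "HOL-Library.Poly_Mapping" "HOL-Real_Asymp.Real_Asymp"
begin

text \<open>
  The idea is that zeros in the base \<open>p\<close> expansion of \<open>j\<close> make the \<open>j\<close>-th iterate sparse, and
  that almost every \<open>j\<close> has many blocks of zeros.

  A linear cellular automaton is the action of a Laurent polynomial \<open>P\<close> with at least two terms over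
  the field with \<open>p\<close> elements, and its iterates are the powers of \<open>P\<close>. By the Frobenius map,
  \<open>P ^ (i * p ^ k + t) = (P ^ i) ^ (p ^ k) * P ^ t\<close>, where the first factor is \<open>P ^ i\<close> with all
  exponents dilated by \<open>p ^ k\<close>. If the diameter of \<open>P ^ t\<close>, at most \<open>t\<close> times that of \<open>P\<close>, is less
  than \<open>p ^ k\<close>, the product consists of disjoint translates of multiples of \<open>P ^ t\<close>, one for each
  term of \<open>P ^ i\<close>; this happens as soon as \<open>j = i * p ^ k + t\<close> has a block of \<open>L\<close> zeros just below
  position \<open>k\<close>, for a constant \<open>L\<close> that depends only on \<open>P\<close>. Two conclusions are drawn.

  First, every digit \<open>1\<close> with \<open>L\<close> zeros on either side doubles the number of terms of the power
  (\<open>two_power_digit_count_le_card_keys\<close>). Secondly, at such a digit in a sufficiently high position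
  the composition of a character \<open>\<psi>\<close> with the iterate is a product of translates of \<open>\<psi> \<circ> P ^ t\<close>
  that are not only disjoint but \<open>S\<close>-separated, one for each term coming from the higher digits; they
  are nontrivial because a power of \<open>P\<close> cannot annihilate a nontrivial character
  (\<open>nontrivial_comp_act_power\<close>). Together, the rank grows exponentially in the number of these digit
  patterns, up to a constant (\<open>two_power_digit_count_le_rank\<close>).

  Finally, counting the pattern as a single digit in base \<open>p ^ (2 * L + 1)\<close>, a Markov inequality for
  the sum of \<open>2 ^ (- digit_count q w j)\<close> over \<open>j\<close> shows that the number of occurrences tends to
  infinity along a set of density one (\<open>density_one_digit_count_at_top\<close>).
\<close>

alias keys = Poly_Mapping.keys
alias lookup = Poly_Mapping.lookup
alias monom = Poly_Mapping.single

section \<open>Laurent polynomials acting on configurations\<close>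

text \<open>
  Laurent polynomials in \<open>D\<close> variables over the field with \<open>p\<close> elements act on configurations, the
  monomial with exponent \<open>v\<close> as the shift by \<open>v\<close>. They form a commutative ring, in which the
  iterates of a linear cellular automaton are the powers of one polynomial.
\<close>
definition act ::
  "(int ^ 'd \<Rightarrow>\<^sub>0 'p mod_ring)
    \<Rightarrow> ('p::prime_card, 's::finite, 'd::finite) config \<Rightarrow> ('p, 's, 'd) config" where
  "act P a = (\<lambda>m. \<Sum>v\<in>keys P. lookup P v *s a (m - v))"

lemma act_add_left: "act (P + Q) a = act P a + act Q a"
  unfolding act_def plus_fun_def
  by (rule ext, rule setsum_keys_plus_distrib) (auto simp: vec_eq_iff algebra_simps)

lemma act_zero [simp]: "act 0 a = 0"
  by (simp add: act_def zero_fun_def)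

lemma act_sum: "act (\<Sum>i\<in>I. P i) a m = (\<Sum>i\<in>I. act (P i) a m)"
  by (induction I rule: infinite_finite_induct) (auto simp: act_add_left)

lemma act_single: "act (monom v c) a = (\<lambda>m. c *s a (m - v))"
  by (cases "c = 0") (auto simp: act_def)

lemma act_one [simp]: "act 1 a = a"
  unfolding single_one[symmetric] act_single by simp

lemma sum_single_lookup:
  "(\<Sum>v\<in>keys P. monom v (lookup P v)) = P"
proof (rule poly_mapping_eqI)
  fix u
  have "lookup (\<Sum>v\<in>keys P. monom v (lookup P v)) u
      = (\<Sum>v\<in>keys P. if v = u then lookup P u else 0)"
    unfolding lookup_sum by (rule sum.cong) (auto simp: lookup_single when_def)
  then show "lookup (\<Sum>v\<in>keys P. monom v (lookup P v)) u = lookup P u"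
    by (simp add: in_keys_iff)
qed

lemma act_single_mult: "act (monom v c * Q) a = act (monom v c) (act Q a)"
proof -
  have "act (monom v c * Q) a
      = act (\<Sum>u\<in>keys Q. monom (v + u) (c * lookup Q u)) a"
    by (subst (1) sum_single_lookup[of Q, symmetric]) (simp add: sum_distrib_left mult_single)
  also have "\<dots> = act (monom v c) (act Q a)"
    by (rule ext) (simp add: act_sum act_single act_def[of Q] vec.scale_sum_right algebra_simps)
  finally show ?thesis .
qed

lemma act_mult: "act (P * Q) a = act P (act Q a)"
proof -
  have "act (P * Q) a = act (\<Sum>v\<in>keys P. monom v (lookup P v) * Q) a"
    by (subst (1) sum_single_lookup[of P, symmetric]) (simp add: sum_distrib_right)
  also have "\<dots> = act (\<Sum>v\<in>keys P. monom v (lookup P v)) (act Q a)"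
    by (rule ext) (simp only: act_sum act_single_mult)
  finally show ?thesis by (simp only: sum_single_lookup)
qed

lemma act_funpow: "act P ^^ n = act (P ^ n)"
  by (induction n) (auto simp: act_mult intro!: ext)

lemma act_add_right: "act P (a + b) = act P a + act P b"
  by (auto simp: act_def sum.distrib vec.scale_right_distrib)

text \<open>
  The coefficients stay nonzero modulo \<open>p\<close>, so no shift of \<open>F\<close> is lost in the polynomial.
\<close>
lemma shift_sum_eq_act:
  fixes \<phi> :: "int ^ 'd::finite \<Rightarrow> int"
  assumes "finite F" and nz: "\<forall>f\<in>F. \<not> [\<phi> f = 0] (mod int CARD('p))"
  obtains P :: "int ^ 'd \<Rightarrow>\<^sub>0 'p::prime_card mod_ring"
  where "keys P = F"
    and "(shift_sum F \<phi> :: ('p, 's::finite, 'd) config \<Rightarrow> ('p, 's, 'd) config) = act P"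
proof -
  define P :: "int ^ 'd \<Rightarrow>\<^sub>0 'p mod_ring"
    where "P = (\<Sum>f\<in>F. monom f (of_int (\<phi> f)))"
  have P: "lookup P f = (if f \<in> F then of_int (\<phi> f) else 0)" for f
  proof -
    have "lookup P f = (\<Sum>g\<in>F. if g = f then of_int (\<phi> f) else 0)"
      unfolding P_def lookup_sum by (rule sum.cong) (auto simp: lookup_single when_def)
    then show ?thesis using \<open>finite F\<close> by simp
  qed
  have "of_int (\<phi> f) \<noteq> (0 :: 'p mod_ring)" if "f \<in> F" for f
    using nz that by (auto simp: cong_def of_int_eq_0_iff_char_dvd mod_eq_0_iff_dvd)
  then have "keys P = F"
    by (auto simp: in_keys_iff P split: if_splits)
  moreover have "shift_sum F \<phi> = act P"
    using calculation by (auto simp: shift_sum_def act_def shift_def P fun_eq_iff intro!: sum.cong)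
  ultimately show ?thesis by (rule that)
qed

section \<open>The Frobenius map spreads exponents out\<close>

lemma l1_triangle:
  fixes x y :: "int ^ 'd::finite"
  shows "l1 (x + y) \<le> l1 x + l1 y"
  unfolding l1_def sum.distrib[symmetric] by (rule sum_mono) (simp add: abs_triangle_ineq)

lemma l1_nonneg: "0 \<le> l1 (x :: int ^ 'd::finite)"
  unfolding l1_def by (rule sum_nonneg) simp

lemma l1_zero_iff: "l1 (x :: int ^ 'd::finite) = 0 \<longleftrightarrow> x = 0"
  by (simp add: l1_def sum_nonneg_eq_0_iff vec_eq_iff)

lemma l1_scale: "l1 (c *s x :: int ^ 'd::finite) = \<bar>c\<bar> * l1 x"
  by (simp add: l1_def abs_mult sum_distrib_left)

lemma le_l1_scale_diff:
  fixes u v :: "int ^ 'd::finite"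
  assumes "u \<noteq> v"
  shows "int q \<le> l1 (int q *s u - int q *s v)"
proof -
  have "1 \<le> l1 (u - v)"
    using assms l1_nonneg[of "u - v"] l1_zero_iff[of "u - v"] by simp
  then show ?thesis
    by (simp add: l1_scale mult_le_cancel_left1 flip: vector_ssub_ldistrib)
qed

text \<open>
  The bound \<open>r\<close> is a parameter instead of a maximum, because only upper bounds of diameters add up
  when polynomials are multiplied.
\<close>
definition spread :: "int \<Rightarrow> (int ^ 'd::finite) set \<Rightarrow> bool" where
  "spread r A \<longleftrightarrow> (\<forall>u\<in>A. \<forall>v\<in>A. l1 (u - v) \<le> r)"

lemma finite_spread:
  assumes "finite A"
  obtains r where "spread (int r) A"
proof -
  let ?B = "(\<lambda>(u, v). l1 (u - v)) ` (A \<times> A)"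
  have "l1 (u - v) \<le> int (nat (Max (insert 0 ?B)))" if "u \<in> A" "v \<in> A" for u v
  proof -
    have "l1 (u - v) \<le> Max (insert 0 ?B)"
      using assms that by (intro Max_ge) auto
    then show ?thesis by linarith
  qed
  then show ?thesis using that unfolding spread_def by blast
qed

lemma spread_keys_power:
  assumes "spread r (keys P)"
  shows "spread (int n * r) (keys (P ^ n))"
proof (induction n)
  case 0
  then show ?case by (simp add: spread_def l1_def)
next
  case (Suc n)
  show ?case unfolding spread_def
  proof (intro ballI)
    fix u v assume "u \<in> keys (P ^ Suc n)" "v \<in> keys (P ^ Suc n)"
    then obtain u1 u2 v1 v2 where
      "u = u1 + u2" "v = v1 + v2" "u1 \<in> keys P" "v1 \<in> keys P" "u2 \<in> keys (P ^ n)" "v2 \<in> keys (P ^ n)"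
      using keys_mult[of P "P ^ n"] by auto blast
    moreover from this have "l1 (u1 - v1) \<le> r" "l1 (u2 - v2) \<le> int n * r"
      using assms Suc by (auto simp: spread_def)
    moreover have "u1 + u2 - (v1 + v2) = (u1 - v1) + (u2 - v2)" by simp
    ultimately show "l1 (u - v) \<le> int (Suc n) * r"
      using l1_triangle[of "u1 - v1" "u2 - v2"] by (simp add: algebra_simps)
  qed
qed

lemma CHAR_poly_mapping:
  "CHAR(int ^ 'd::finite \<Rightarrow>\<^sub>0 'p::prime_card mod_ring) = CARD('p)"
proof -
  have *: "(of_nat n :: int ^ 'd \<Rightarrow>\<^sub>0 'p mod_ring) = 0 \<longleftrightarrow> (of_nat n :: 'p mod_ring) = 0" for n
  proof -
    have "monom (0 :: int ^ 'd) c = 0 \<longleftrightarrow> c = 0" for c :: "'p mod_ring"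
      by (metis lookup_single_eq lookup_zero single_zero)
    then show ?thesis by (simp flip: single_of_nat)
  qed
  show ?thesis
    by (rule CHAR_eqI) (use * in \<open>auto simp: of_nat_eq_0_iff_char_dvd\<close>)
qed

lemma single_power:
  "monom (v :: int ^ 'd::finite) (c :: 'a::comm_semiring_1) ^ n
    = monom (int n *s v) (c ^ n)"
proof (induction n)
  case (Suc n)
  have "v + int n *s v = int (Suc n) *s v" by (simp add: vec_eq_iff algebra_simps)
  then show ?case by (simp add: Suc mult_single)
qed simp

text \<open>
  The Frobenius map: raising to the power \<open>p ^ k\<close> is additive in characteristic \<open>p\<close> and fixes the
  coefficients, so it only dilates the exponents. This is the source of all the sparseness below.
\<close>
lemma power_eq_sum_single:
  fixes P :: "int ^ 'd::finite \<Rightarrow>\<^sub>0 'p::prime_card mod_ring"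
  assumes "q = CARD('p) ^ k"
  shows "P ^ q = (\<Sum>v\<in>keys P. monom (int q *s v) (lookup P v))"
proof -
  have fermat: "c ^ q = c" for c :: "'p mod_ring"
    using finite_field_power_card_power_eq_same[of q k c] assms by simp
  have "P ^ q = (\<Sum>v\<in>keys P. monom v (lookup P v)) ^ q"
    by (simp add: sum_single_lookup)
  also have "\<dots> = (\<Sum>v\<in>keys P. monom v (lookup P v) ^ q)"
    by (rule freshmans_dream_sum'[where n = k]) (simp_all add: CHAR_poly_mapping assms prime_card)
  finally show ?thesis by (simp add: single_power fermat)
qed

lemma lookup_single_mult:
  fixes t m :: "int ^ 'd::finite"
  shows "lookup (monom t c * Q) m = c * lookup Q (m - t)"
proof -
  have "lookup (monom t c * Q) m
      = (\<Sum>u\<in>keys Q. lookup (monom (t + u) (c * lookup Q u)) m)"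
    by (subst (1) sum_single_lookup[of Q, symmetric])
       (simp add: sum_distrib_left mult_single lookup_sum)
  also have "\<dots> = (\<Sum>u\<in>keys Q. if u = m - t then c * lookup Q (m - t) else 0)"
    by (rule sum.cong) (auto simp: lookup_single when_def)
  finally show ?thesis by (simp add: in_keys_iff)
qed

text \<open>
  The exponents of \<open>P ^ q\<close> are at least \<open>q\<close> apart, so the product with \<open>Q\<close> consists of disjoint
  translates of multiples of \<open>Q\<close>, and nothing cancels.
\<close>
lemma card_keys_power_mult:
  fixes P Q :: "int ^ 'd::finite \<Rightarrow>\<^sub>0 'p::prime_card mod_ring"
  assumes q: "q = CARD('p) ^ k" and r: "spread r (keys Q)" "r < int q"
  shows "card (keys P) * card (keys Q) \<le> card (keys (P ^ q * Q))"
proof -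
  let ?h = "\<lambda>(v, u). int q *s v + u"
  have far: "v = v'" if "u \<in> keys Q" "u' \<in> keys Q" "int q *s v + u = int q *s v' + u'" for v v' u u'
  proof (rule ccontr)
    assume "v \<noteq> v'"
    then have "int q \<le> l1 (int q *s v - int q *s v')" by (rule le_l1_scale_diff)
    moreover have "int q *s v - int q *s v' = u' - u" using that(3) by (simp add: algebra_simps)
    moreover have "l1 (u' - u) \<le> r" using r(1) that(1,2) by (simp add: spread_def)
    ultimately show False using r(2) by simp
  qed
  have "inj_on ?h (keys P \<times> keys Q)"
  proof (rule inj_onI, clarify)
    fix v u v' u' assume "u \<in> keys Q" "u' \<in> keys Q" "int q *s v + u = int q *s v' + u'"
    with far[of u u' v v'] show "v = v' \<and> u = u'" by simp
  qed
  then have "card (keys P) * card (keys Q) = card (?h ` (keys P \<times> keys Q))"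
    by (simp add: card_image card_cartesian_product)
  also have "\<dots> \<le> card (keys (P ^ q * Q))"
  proof (rule card_mono)
    show "?h ` (keys P \<times> keys Q) \<subseteq> keys (P ^ q * Q)"
    proof clarify
      fix v u assume v: "v \<in> keys P" and u: "u \<in> keys Q"
      let ?m = "int q *s v + u"
      have "lookup (P ^ q * Q) ?m = (\<Sum>v'\<in>keys P. lookup P v' * lookup Q (?m - int q *s v'))"
        unfolding power_eq_sum_single[OF q] sum_distrib_right lookup_sum lookup_single_mult ..
      also have "\<dots> = (\<Sum>v'\<in>keys P. if v' = v then lookup P v * lookup Q u else 0)"
      proof (rule sum.cong)
        fix v' assume "v' \<in> keys P"
        show "lookup P v' * lookup Q (?m - int q *s v') = (if v' = v then lookup P v * lookup Q u else 0)"
          using far[of u "?m - int q *s v'" v v'] u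
          by (cases "?m - int q *s v' \<in> keys Q") (auto simp: in_keys_iff)
      qed simp
      also have "\<dots> = lookup P v * lookup Q u" using v by simp
      finally show "?m \<in> keys (P ^ q * Q)" using u v by (simp add: in_keys_iff)
    qed
  qed simp
  finally show ?thesis .
qed

text \<open>
  For a suitable exponent \<open>p ^ k\<close> at least \<open>n\<close> the power is a dilation of \<open>P\<close>, hence nonzero; it is
  a multiple of \<open>P ^ n\<close>.
\<close>
lemma power_nonzero:
  fixes P :: "int ^ 'd::finite \<Rightarrow>\<^sub>0 'p::prime_card mod_ring"
  assumes "P \<noteq> 0"
  shows "P ^ n \<noteq> 0"
proof
  assume "P ^ n = 0"
  define q where "q = CARD('p) ^ n"
  have "n < q"
    unfolding q_def using prime_gt_1_nat[OF prime_card[where 'a = 'p]] by (simp add: power_gt_expt)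
  then have "P ^ q = P ^ n * P ^ (q - n)" by (simp flip: power_add)
  then have "P ^ q = 0" using \<open>P ^ n = 0\<close> by simp
  moreover have "card (keys P) * card (keys (1 :: int ^ 'd \<Rightarrow>\<^sub>0 'p mod_ring)) \<le> card (keys (P ^ q * 1))"
    by (rule card_keys_power_mult[OF q_def, where r = 0]) (use \<open>n < q\<close> in \<open>auto simp: spread_def l1_def\<close>)
  ultimately show False using assms by simp
qed

section \<open>Characters and lower bounds for their rank\<close>

lemma has_support_support:
  fixes \<psi> :: "('p::prime_card, 's::finite, 'd::finite) config \<Rightarrow> complex"
  assumes "character \<psi>"
  shows "has_support \<psi> (support \<psi>)"
  unfolding support_def by (rule theI') (rule ex1_support[OF assms])

lemma mem_support_iff:
  assumes "character \<psi>"
  shows "k \<in> support \<psi> \<longleftrightarrow> nontrivial (\<lambda>x. \<psi> (Defs.single k x))"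
  using has_support_unique[OF has_support_support[OF assms]] by blast

lemma finite_support: "character \<psi> \<Longrightarrow> finite (support \<psi>)"
  using has_support_support has_support_def by blast

lemma character_eq_1:
  fixes \<psi> :: "('p::prime_card, 's::finite, 'd::finite) config \<Rightarrow> complex"
  assumes "character \<psi>" "\<forall>k\<in>support \<psi>. a k = 0"
  shows "\<psi> a = 1"
proof -
  obtain c where c: "\<forall>k\<in>support \<psi>. circle_hom (c k)" "\<psi> = (\<lambda>a. \<Prod>k\<in>support \<psi>. c k (a k))"
    using has_support_support[OF assms(1)] unfolding has_support_def by blast
  have "\<psi> a = (\<Prod>k\<in>support \<psi>. c k (a k))" using c(2) by (rule fun_cong)
  also have "\<dots> = 1" using c(1) assms(2) by (intro prod.neutral) (auto simp: circle_hom_zero)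
  finally show ?thesis .
qed

lemma support_nonempty:
  assumes "character \<psi>" "nontrivial \<psi>"
  shows "support \<psi> \<noteq> {}"
  using character_eq_1[OF assms(1)] assms(2) by (auto simp: nontrivial_def)

text \<open>
  For a homomorphism into the circle, being a character means depending on finitely many cells only:
  it is then a finite product of functions of single cells, and these are continuous. Since \<open>B\<close> may
  be larger than the support, the criterion is easy to apply to compositions.
\<close>
lemma character_if_local:
  fixes \<psi> :: "('p::prime_card, 's::finite, 'd::finite) config \<Rightarrow> complex"
  assumes h: "circle_hom \<psi>" and "finite B" and loc: "\<And>a. (\<forall>k\<in>B. a k = 0) \<Longrightarrow> \<psi> a = 1"
  shows "character \<psi>" and "support \<psi> \<subseteq> B"
proof -
  have s: "(\<Sum>k\<in>B. Defs.single k (a k)) m = (if m \<in> B then a m else 0)" for a :: "('p, 's, 'd) config" and m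
  proof -
    have "(\<Sum>k\<in>B'. Defs.single k (a k)) m = (if m \<in> B' then a m else 0)" if "finite B'" for B'
      using that by (induction B' rule: finite_induct) (auto simp: Defs.single_def)
    then show ?thesis using \<open>finite B\<close> .
  qed
  have prod: "\<psi> a = (\<Prod>k\<in>B. \<psi> (Defs.single k (a k)))" for a
  proof -
    define r where "r = a - (\<Sum>k\<in>B. Defs.single k (a k))"
    have "\<psi> r = 1" by (rule loc) (auto simp: r_def s)
    moreover have "\<psi> (r + (\<Sum>k\<in>B. Defs.single k (a k))) = \<psi> r * \<psi> (\<Sum>k\<in>B. Defs.single k (a k))"
      using h by (simp add: circle_hom_def)
    ultimately show ?thesis by (simp add: r_def circle_hom_funsum[OF h \<open>finite B\<close>])
  qed
  have "continuous_map config_topology euclidean (\<lambda>a. \<psi> (Defs.single k (a k)))" for k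
  proof -
    have "continuous_map config_topology (discrete_topology UNIV) (\<lambda>a :: ('p, 's, 'd) config. a k)"
      unfolding config_topology_def by (rule continuous_map_product_projection) simp
    moreover have "continuous_map (discrete_topology UNIV) euclidean (\<lambda>x. \<psi> (Defs.single k x))"
      by simp
    ultimately show ?thesis
      using continuous_map_compose[of config_topology "discrete_topology UNIV" "\<lambda>a. a k" euclidean
          "\<lambda>x. \<psi> (Defs.single k x)"] by (simp add: o_def)
  qed
  then have "continuous_map config_topology euclidean (\<lambda>a. \<Prod>k\<in>B. \<psi> (Defs.single k (a k)))"
    by (simp add: continuous_map_atin tendsto_prod)
  then have "continuous_map config_topology euclidean \<psi>"
    by (simp flip: prod)
  then show char: "character \<psi>" using h by (simp add: character_def)
  have "\<psi> (Defs.single k x) = 1" if "k \<notin> B" for k x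
    by (rule loc) (use that in \<open>auto simp: Defs.single_def\<close>)
  then show "support \<psi> \<subseteq> B"
    using mem_support_iff[OF char] unfolding nontrivial_def by blast
qed

text \<open>
  The rank is a maximum, so a decomposition bounds it from below only once the number of factors in
  any decomposition is known to be bounded. Separated factors have disjoint supports, hence a cell
  in the support of one factor is in the support of the product; the size of the support of \<open>\<psi>\<close> is
  therefore such a bound.
\<close>
lemma card_le_rank:
  fixes \<psi> :: "('p::prime_card, 's::finite, 'd::finite) config \<Rightarrow> complex"
  assumes "0 < S" "character \<psi>" "finite V" "V \<noteq> {}"
    and \<xi>: "\<And>v. v \<in> V \<Longrightarrow> character (\<xi> v) \<and> nontrivial (\<xi> v)"
    and sep: "\<And>u v. u \<in> V \<Longrightarrow> v \<in> V \<Longrightarrow> u \<noteq> v \<Longrightarrow> separated S (\<xi> u) (\<xi> v)"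
    and \<psi>: "\<And>a. \<psi> a = (\<Prod>v\<in>V. \<xi> v a)"
  shows "card V \<le> rank S \<psi>"
proof -
  define good where "good R \<zeta> \<longleftrightarrow> (\<forall>i<R. character (\<zeta> i) \<and> nontrivial (\<zeta> i))
       \<and> (\<forall>i<R. \<forall>j<R. i \<noteq> j \<longrightarrow> separated S (\<zeta> i) (\<zeta> j))
       \<and> \<psi> = (\<lambda>a. \<Prod>i<R. \<zeta> i a)" for R and \<zeta> :: "nat \<Rightarrow> ('p, 's, 'd) config \<Rightarrow> complex"
  have le: "R \<le> card (support \<psi>)" if good: "good R \<zeta>" for R \<zeta>
  proof -
    have char: "character (\<zeta> i)" and nt: "nontrivial (\<zeta> i)" if "i < R" for i
      using good that by (simp_all add: good_def)
    have sep: "separated S (\<zeta> i) (\<zeta> j)" if "i < R" "j < R" "i \<noteq> j" for i j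
      using good that by (simp add: good_def)
    have "\<exists>k. k \<in> support (\<zeta> i)" if "i < R" for i
      using support_nonempty[OF char[OF that] nt[OF that]] by blast
    then obtain k where k: "\<And>i. i < R \<Longrightarrow> k i \<in> support (\<zeta> i)" by metis
    \<comment> \<open>A common cell of two supports has distance \<open>0 < S\<close> from itself.\<close>
    have disj: "i = j" if "i < R" "j < R" "k i \<in> support (\<zeta> j)" for i j
    proof (rule ccontr)
      assume "i \<noteq> j"
      then have "real_of_int (l1 (k i - k i)) \<ge> S"
        using sep[OF that(1,2)] k[OF that(1)] that(3) unfolding separated_def by blast
      then show False using \<open>0 < S\<close> by (simp add: l1_def)
    qed
    have "k i \<in> support \<psi>" if i: "i < R" for i
    proof -
      have "\<psi> (Defs.single (k i) x) = \<zeta> i (Defs.single (k i) x)" for x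
      proof -
        have "\<psi> (Defs.single (k i) x) = (\<Prod>j<R. if j = i then \<zeta> i (Defs.single (k i) x) else 1)"
        proof -
          have "\<psi> (Defs.single (k i) x) = (\<Prod>j<R. \<zeta> j (Defs.single (k i) x))"
            using good by (simp add: good_def)
          also have "\<dots> = (\<Prod>j<R. if j = i then \<zeta> i (Defs.single (k i) x) else 1)"
          proof (rule prod.cong)
            fix j assume j: "j \<in> {..<R}"
            show "\<zeta> j (Defs.single (k i) x) = (if j = i then \<zeta> i (Defs.single (k i) x) else 1)"
            proof (cases "j = i")
              case False
              then have "k i \<notin> support (\<zeta> j)" using disj i j by blast
              then show ?thesis
                using False character_eq_1[OF char, of j "Defs.single (k i) x"] j
                by (auto simp: Defs.single_def)
            qed simp
          qed simp
          finally show ?thesis .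
        qed
        then show ?thesis using i by simp
      qed
      moreover have "nontrivial (\<lambda>x. \<zeta> i (Defs.single (k i) x))"
        using k[OF i] mem_support_iff[OF char[OF i]] by simp
      ultimately show ?thesis using mem_support_iff[OF \<open>character \<psi>\<close>] by simp
    qed
    moreover have "inj_on k {..<R}"
      by (rule inj_onI) (use disj k in force)
    ultimately have "card {..<R} \<le> card (support \<psi>)"
      using finite_support[OF \<open>character \<psi>\<close>] by (intro card_inj_on_le[of k]) auto
    then show ?thesis by simp
  qed
  obtain h where h: "bij_betw h {..<card V} V"
    using ex_bij_betw_nat_finite[OF \<open>finite V\<close>] by (auto simp: atLeast0LessThan)
  have "good (card V) (\<lambda>i. \<xi> (h i))"
    unfolding good_def
  proof (intro conjI allI impI)
    fix i assume "i < card V"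
    then have "h i \<in> V" using h by (auto simp: bij_betw_def)
    then show "character (\<xi> (h i))" "nontrivial (\<xi> (h i))" using \<xi> by auto
    fix j assume "j < card V" "i \<noteq> j"
    then have "h j \<in> V" "h i \<noteq> h j" using h \<open>i < card V\<close> by (auto simp: bij_betw_def inj_on_def)
    then show "separated S (\<xi> (h i)) (\<xi> (h j))" using sep \<open>h i \<in> V\<close> by blast
  next
    show "\<psi> = (\<lambda>a. \<Prod>i<card V. \<xi> (h i) a)"
    proof
      fix a
      show "\<psi> a = (\<Prod>i<card V. \<xi> (h i) a)"
        using prod.reindex_bij_betw[OF h, of "\<lambda>v. \<xi> v a"] by (simp add: \<psi>)
    qed
  qed
  moreover from this have "card V \<le> card (support \<psi>)" by (rule le)
  then have "support \<psi> \<noteq> {}" using \<open>finite V\<close> \<open>V \<noteq> {}\<close> by auto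
  then have "nontrivial \<psi>"
    using mem_support_iff[OF \<open>character \<psi>\<close>] by (auto simp: nontrivial_def)
  then have "rank S \<psi> = Max {R. \<exists>\<zeta>. good R \<zeta>}"
    unfolding rank_def good_def by simp
  moreover have "{R. \<exists>\<zeta>. good R \<zeta>} \<subseteq> {..card (support \<psi>)}" using le by auto
  ultimately show ?thesis by (metis (mono_tags, lifting) Max_ge finite_atMost finite_subset mem_Collect_eq)
qed

lemma circle_hom_comp_act:
  assumes "circle_hom \<psi>"
  shows "circle_hom (\<lambda>a. \<psi> (act P a))"
  using assms by (simp add: circle_hom_def act_add_right)

lemma character_comp_act:
  fixes \<psi> :: "('p::prime_card, 's::finite, 'd::finite) config \<Rightarrow> complex"
  assumes "character \<psi>"
  shows "character (\<lambda>a. \<psi> (act P a))"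
    and "support (\<lambda>a. \<psi> (act P a)) \<subseteq> {k - v | k v. k \<in> support \<psi> \<and> v \<in> keys P}"
proof -
  let ?B = "{k - v | k v. k \<in> support \<psi> \<and> v \<in> keys P}"
  have h: "circle_hom (\<lambda>a. \<psi> (act P a))"
    using assms by (intro circle_hom_comp_act) (simp add: character_def)
  have "?B = (\<lambda>(k, v). k - v) ` (support \<psi> \<times> keys P)" by auto
  then have fin: "finite ?B" using finite_support[OF assms] by simp
  have loc: "\<psi> (act P a) = 1" if "\<forall>k\<in>?B. a k = 0" for a
  proof (rule character_eq_1[OF assms], rule ballI)
    fix k assume "k \<in> support \<psi>"
    then have "a (k - v) = 0" if "v \<in> keys P" for v using \<open>\<forall>k\<in>?B. a k = 0\<close> that by blast
    then show "act P a k = 0" by (simp add: act_def)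
  qed
  show "character (\<lambda>a. \<psi> (act P a))" "support (\<lambda>a. \<psi> (act P a)) \<subseteq> ?B"
    using character_if_local[OF h fin loc] by blast+
qed

text \<open>
  It suffices to treat a larger exponent \<open>q = p ^ k\<close>. The automaton given by \<open>P ^ q\<close> writes scaled
  copies of a single nonzero cell at mutual distance at least \<open>q\<close>. If \<open>q\<close> exceeds the diameter of
  the support of \<open>\<psi>\<close>, exactly one copy can be placed where \<open>\<psi>\<close> sees it, and the copy can be any
  symbol on which \<open>\<psi>\<close> is nontrivial.
\<close>
lemma nontrivial_comp_act_power:
  fixes \<psi> :: "('p::prime_card, 's::finite, 'd::finite) config \<Rightarrow> complex"
  assumes \<psi>: "character \<psi>" "nontrivial \<psi>" and "P \<noteq> 0"
  shows "nontrivial (\<lambda>a. \<psi> (act (P ^ n) a))"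
  unfolding nontrivial_def
proof
  assume "(\<lambda>a. \<psi> (act (P ^ n) a)) = (\<lambda>_. 1)"
  then have triv: "\<psi> (act (P ^ n) a) = 1" for a by meson
  obtain r where r: "spread (int r) (support \<psi>)"
    using finite_spread[OF finite_support[OF \<psi>(1)]] by blast
  define q where "q = CARD('p) ^ (n + r)"
  have "n + r < q"
    unfolding q_def using prime_gt_1_nat[OF prime_card[where 'a = 'p]] by (simp add: power_gt_expt)
  then have "n \<le> q" "r < q" by auto
  have triv_q: "\<psi> (act (P ^ q) a) = 1" for a
  proof -
    have "P ^ q = P ^ n * P ^ (q - n)" using \<open>n \<le> q\<close> by (simp flip: power_add)
    then show ?thesis using triv by (simp add: act_mult)
  qed
  obtain k x where k: "k \<in> support \<psi>" "\<psi> (Defs.single k x) \<noteq> 1"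
    using support_nonempty[OF \<psi>] mem_support_iff[OF \<psi>(1)] by (force simp: nontrivial_def)
  \<comment> \<open>The term \<open>f\<close> moves the cell of \<open>a\<close> to \<open>k\<close>, and the inverse cancels its coefficient.\<close>
  obtain f where f: "f \<in> keys P" using \<open>P \<noteq> 0\<close> by (metis ex_in_conv keys_eq_empty)
  define a where "a = (Defs.single (k - int q *s f) (inverse (lookup P f) *s x) :: ('p, 's, 'd) config)"
  have val: "act (P ^ q) a m = (\<Sum>v\<in>keys P. lookup P v *s a (m - int q *s v))" for m
    unfolding power_eq_sum_single[OF q_def] by (simp add: act_sum act_single)
  have "(act (P ^ q) a - Defs.single k x) m = 0" if m: "m \<in> support \<psi>" for m
  proof -
    have "lookup P v *s a (m - int q *s v) = (if v = f then Defs.single k x m else 0)" if "v \<in> keys P" for v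
    proof (cases "v = f")
      case True
      then show ?thesis using f by (auto simp: a_def Defs.single_def in_keys_iff)
    next
      case False
      have "m - int q *s v \<noteq> k - int q *s f"
      proof
        assume "m - int q *s v = k - int q *s f"
        then have "m - k = int q *s v - int q *s f" by (simp add: algebra_simps)
        then have "int q \<le> l1 (m - k)" using le_l1_scale_diff[OF False, of q] by simp
        moreover have "l1 (m - k) \<le> int r" using r m k(1) by (simp add: spread_def)
        ultimately show False using \<open>r < q\<close> by simp
      qed
      then show ?thesis using False by (simp add: a_def Defs.single_def)
    qed
    then have "act (P ^ q) a m = (\<Sum>v\<in>keys P. if v = f then Defs.single k x m else 0)"
      unfolding val by (intro sum.cong) auto
    then show ?thesis using f by simp
  qed
  then have "\<psi> (act (P ^ q) a - Defs.single k x) = 1"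
    by (intro character_eq_1[OF \<psi>(1)]) blast
  moreover have "\<psi> (act (P ^ q) a - Defs.single k x + Defs.single k x)
      = \<psi> (act (P ^ q) a - Defs.single k x) * \<psi> (Defs.single k x)"
    using \<psi>(1) unfolding character_def circle_hom_def by blast
  ultimately show False using triv_q[of a] k(2) by simp
qed

lemma act_monom_inverse:
  assumes "c \<noteq> 0"
  shows "act (monom v c) (act (monom (- v) (inverse c)) a) = a"
  using assms by (simp add: act_single)

text \<open>
  Each monomial of \<open>P ^ q\<close> contributes one factor, a translate of a multiple of \<open>\<psi> \<circ> act Q\<close>.
  All these factors live on sets of diameter at most \<open>r + t\<close>, while the translations differ by at
  least \<open>q\<close>.
\<close>
lemma card_keys_le_rank:
  fixes \<psi> :: "('p::prime_card, 's::finite, 'd::finite) config \<Rightarrow> complex"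
  assumes "0 < S" and \<psi>: "character \<psi>" and nt: "nontrivial (\<lambda>a. \<psi> (act Q a))" and "P \<noteq> 0"
    and q: "q = CARD('p) ^ k" and r: "spread r (keys Q)" "spread t (support \<psi>)"
    and S: "S + real_of_int (r + t) \<le> real q"
  shows "card (keys P) \<le> rank S (\<lambda>a. \<psi> (act (P ^ q * Q) a))"
proof (rule card_le_rank)
  define \<xi> where "\<xi> v a = \<psi> (act (monom (int q *s v) (lookup P v) * Q) a)" for v a
  have supp: "\<exists>k\<in>support \<psi>. \<exists>u\<in>keys Q. m = k - (int q *s v + u)" if "m \<in> support (\<xi> v)" for v m
  proof -
    have "m \<in> {k - u | k u. k \<in> support \<psi> \<and> u \<in> keys (monom (int q *s v) (lookup P v) * Q)}"
      using character_comp_act(2)[OF \<psi>] that unfolding \<xi>_def by blast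
    then show ?thesis
      using keys_mult[of "monom (int q *s v) (lookup P v)" Q] by (auto split: if_splits) blast
  qed
  show "0 < S" by fact
  show "character (\<lambda>a. \<psi> (act (P ^ q * Q) a))" by (rule character_comp_act(1)[OF \<psi>])
  show "keys P \<noteq> {}" using \<open>P \<noteq> 0\<close> by simp
  show "character (\<xi> v) \<and> nontrivial (\<xi> v)" if "v \<in> keys P" for v
  proof
    show "character (\<xi> v)" unfolding \<xi>_def by (rule character_comp_act(1)[OF \<psi>])
    show "nontrivial (\<xi> v)"
      unfolding nontrivial_def
    proof
      assume "\<xi> v = (\<lambda>_. 1)"
      then have "\<psi> (act Q (act (monom (int q *s v) (lookup P v)) a)) = 1" for a
        by (metis \<xi>_def act_mult mult.commute)
      then have "\<psi> (act Q a) = 1" for a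
        using act_monom_inverse[of "lookup P v" "int q *s v" a] that by (metis in_keys_iff)
      then show False using nt by (simp add: nontrivial_def)
    qed
  qed
  show "separated S (\<xi> v) (\<xi> v')" if "v \<noteq> v'" for v v'
    unfolding separated_def
  proof (intro ballI)
    fix m m' assume "m \<in> support (\<xi> v)" "m' \<in> support (\<xi> v')"
    then obtain k u k' u' where *: "k \<in> support \<psi>" "k' \<in> support \<psi>" "u \<in> keys Q" "u' \<in> keys Q"
      "m = k - (int q *s v + u)" "m' = k' - (int q *s v' + u')"
      using supp by metis
    have "int q \<le> l1 (int q *s v' - int q *s v)" using that le_l1_scale_diff by metis
    also have "int q *s v' - int q *s v = (m - m') + ((k' - k) + (u - u'))"
      using * by (simp add: algebra_simps)
    also have "l1 \<dots> \<le> l1 (m - m') + (l1 (k' - k) + l1 (u - u'))"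
      by (meson add_left_mono l1_triangle order_trans)
    also have "\<dots> \<le> l1 (m - m') + (t + r)"
      using * r by (intro add_mono) (auto simp: spread_def)
    finally have "real q \<le> real_of_int (l1 (m - m')) + real_of_int (r + t)" by linarith
    then show "S \<le> real_of_int (l1 (m - m'))" using S by linarith
  qed
  show "\<psi> (act (P ^ q * Q) a) = (\<Prod>v\<in>keys P. \<xi> v a)" for a
  proof -
    have "act (P ^ q * Q) a = (\<Sum>v\<in>keys P. act (monom (int q *s v) (lookup P v) * Q) a)"
    proof
      fix m
      have "(\<Sum>v\<in>V. F v) m = (\<Sum>v\<in>V. F v m)" for V and F :: "int ^ 'd \<Rightarrow> ('p, 's, 'd) config"
        by (induction V rule: infinite_finite_induct) auto
      then show "act (P ^ q * Q) a m = (\<Sum>v\<in>keys P. act (monom (int q *s v) (lookup P v) * Q) a) m"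
        unfolding power_eq_sum_single[OF q] sum_distrib_right by (simp add: act_sum)
    qed
    then show ?thesis
      using circle_hom_funsum[of \<psi> "keys P"] \<psi> by (simp add: \<xi>_def character_def)
  qed
qed simp

section \<open>The frequency of a digit\<close>

text \<open>
  The number of occurrences of the digit \<open>w\<close> in the expansion of \<open>j\<close> in base \<open>q\<close>. The leading zeros
  are harmless because only \<open>w > 0\<close> is considered.
\<close>
definition digit_count :: "nat \<Rightarrow> nat \<Rightarrow> nat \<Rightarrow> nat" where
  "digit_count q w j = card {n. j div q ^ n mod q = w}"

lemma finite_digit_positions:
  fixes j q w :: nat
  assumes "0 < w" "w < q"
  shows "finite {n. j div q ^ n mod q = w}"
proof (rule finite_subset)
  show "{n. j div q ^ n mod q = w} \<subseteq> {..j}"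
  proof
    fix n assume "n \<in> {n. j div q ^ n mod q = w}"
    then have "q ^ n \<le> j" using assms by (intro leI notI) auto
    moreover have "n < q ^ n" using assms by (intro power_gt_expt) auto
    ultimately show "n \<in> {..j}" by simp
  qed
qed simp

lemma digit_count_step:
  assumes "0 < w" "w < q" "d < q"
  shows "digit_count q w (i * q + d) = (if d = w then 1 else 0) + digit_count q w i"
proof -
  let ?A = "\<lambda>j. {n. j div q ^ n mod q = w}"
  have shift: "(i * q + d) div q ^ Suc n = i div q ^ n" for n
    using assms by (simp add: div_mult2_eq)
  have "n \<in> ?A (i * q + d) \<longleftrightarrow> n \<in> (if d = w then {0} else {}) \<union> Suc ` ?A i" for n
    using assms shift by (cases n) auto
  then have "?A (i * q + d) = (if d = w then {0} else {}) \<union> Suc ` ?A i"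
    by blast
  then have "digit_count q w (i * q + d) = card ((if d = w then {0} else {}) \<union> Suc ` ?A i)"
    by (simp add: digit_count_def)
  also have "\<dots> = card (if d = w then {0 :: nat} else {}) + card (Suc ` ?A i)"
    using finite_digit_positions[OF assms(1,2)] by (intro card_Un_disjoint) auto
  finally show ?thesis by (simp add: card_image digit_count_def)
qed

text \<open>
  The split is at the lowest occurrence of \<open>w\<close> among the positions from \<open>m\<close> on. Of the occurrences
  in \<open>j\<close>, only this one and those at the \<open>m\<close> lowest positions can be missing in \<open>i\<close>.
\<close>
lemma digit_count_split:
  assumes "0 < w" "w < q" "m < digit_count q w j"
  obtains n i r where "m \<le> n" "r < q ^ n" "j = (i * q + w) * q ^ n + r"
    "digit_count q w j \<le> digit_count q w i + Suc m"
proof -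
  let ?A = "\<lambda>j. {n. j div q ^ n mod q = w}"
  have "\<not> ?A j \<subseteq> {..<m}"
    using card_mono[of "{..<m}" "?A j"] assms(3) by (auto simp: digit_count_def)
  then obtain n0 where "n0 \<in> ?A j" "n0 \<notin> {..<m}" by blast
  then have "\<exists>n. m \<le> n \<and> j div q ^ n mod q = w" by (intro exI[of _ n0]) simp
  define n where "n = (LEAST n. m \<le> n \<and> j div q ^ n mod q = w)"
  have n: "m \<le> n" "j div q ^ n mod q = w"
    using LeastI_ex[OF \<open>\<exists>n. m \<le> n \<and> _ n\<close>] unfolding n_def by auto
  have least: "n \<le> k" if "m \<le> k" "k \<in> ?A j" for k
    using that unfolding n_def by (intro Least_le) auto
  define i where "i = j div q ^ Suc n"
  have "?A j \<subseteq> {..<m} \<union> insert n ((\<lambda>k. k + Suc n) ` ?A i)"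
  proof
    fix k assume k: "k \<in> ?A j"
    consider "k < m" | "k = n" | "Suc n \<le> k" using least[OF _ k] by linarith
    then show "k \<in> {..<m} \<union> insert n ((\<lambda>k. k + Suc n) ` ?A i)"
    proof cases
      case 3
      then obtain l where l: "k = l + Suc n" by (metis le_iff_add add.commute)
      have "i div q ^ l = j div q ^ k"
        unfolding i_def l div_mult2_eq[symmetric] by (simp add: power_add ac_simps)
      with k l show ?thesis by auto
    qed auto
  qed
  then have "digit_count q w j \<le> card ({..<m} \<union> insert n ((\<lambda>k. k + Suc n) ` ?A i))"
    unfolding digit_count_def using finite_digit_positions[OF assms(1,2)] by (intro card_mono) auto
  also have "\<dots> \<le> card {..<m} + card (insert n ((\<lambda>k. k + Suc n) ` ?A i))"
    by (rule card_Un_le)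
  also have "card (insert n ((\<lambda>k. k + Suc n) ` ?A i)) \<le> Suc (card (?A i))"
    using card_image_le[OF finite_digit_positions[OF assms(1,2)], of "\<lambda>k. k + Suc n" i]
    by (intro card_insert_le_m1) simp_all
  finally have "digit_count q w j \<le> digit_count q w i + Suc m"
    by (simp add: digit_count_def)
  moreover have "j = (i * q + w) * q ^ n + j mod q ^ n"
  proof -
    have "i = j div q ^ n div q" by (simp add: i_def div_mult2_eq[symmetric] mult.commute)
    then have "i * q + w = j div q ^ n" using n(2) by (metis div_mult_mod_eq)
    then show ?thesis by (simp only: div_mult_mod_eq)
  qed
  moreover have "j mod q ^ n < q ^ n" using assms by simp
  ultimately show ?thesis using that n(1) by blast
qed

text \<open>
  The digits are independent: one digit contributes the factor \<open>(q - 1) + 1 / 2\<close>.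
\<close>
lemma sum_half_power_digit_count:
  assumes "0 < w" "w < q"
  shows "(\<Sum>j<q ^ M. (1 / 2 :: real) ^ digit_count q w j) = (real q - 1 / 2) ^ M"
proof (induction M)
  case 0
  then show ?case using assms by (simp add: digit_count_def)
next
  case (Suc M)
  let ?f = "\<lambda>j. (1 / 2 :: real) ^ digit_count q w j"
  have block: "sum ?f {i * q..<i * q + q} = (real q - 1 / 2) * ?f i" for i
  proof -
    have "sum ?f {i * q..<i * q + q} = (\<Sum>d<q. ?f (i * q + d))"
      using sum.shift_bounds_nat_ivl[of ?f 0 "i * q" q] by (simp add: atLeast0LessThan ac_simps)
    also have "\<dots> = (\<Sum>d<q. ?f i - (if d = w then ?f i / 2 else 0))"
      by (rule sum.cong) (auto simp: digit_count_step[OF assms])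
    also have "\<dots> = (real q - 1 / 2) * ?f i"
      using assms by (simp add: sum_subtractf algebra_simps)
    finally show ?thesis .
  qed
  have "(\<Sum>j<q ^ Suc M. ?f j) = (\<Sum>i<q ^ M. sum ?f {i * q..<i * q + q})"
    using sum.nat_group[of ?f q "q ^ M"] by (simp add: mult.commute)
  also have "\<dots> = (real q - 1 / 2) * (\<Sum>i<q ^ M. ?f i)"
    by (simp add: block sum_distrib_left)
  finally show ?case using Suc.IH by simp
qed

text \<open>
  The exponent \<open>\<alpha> = log q (q - 1 / 2)\<close> is less than \<open>1\<close>, and \<open>(q - 1 / 2) ^ M = (q ^ M) powr \<alpha>\<close>
  turns the evaluation at the powers of \<open>q\<close> into a sublinear bound for all \<open>N\<close>.
\<close>
lemma sum_half_power_digit_count_le: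
  assumes "0 < w" "w < q" "0 < N"
  shows "(\<Sum>j<N. (1 / 2 :: real) ^ digit_count q w j) \<le> real q * real N powr log q (real q - 1 / 2)"
proof -
  define \<alpha> where "\<alpha> = log q (real q - 1 / 2)"
  have q: "real q \<ge> 2" using assms by linarith
  obtain M where M: "q ^ M \<le> N" "N < q ^ Suc M"
    using ex_power_ivl1[of q N] assms by auto
  have "(\<Sum>j<N. (1 / 2 :: real) ^ digit_count q w j) \<le> (\<Sum>j<q ^ Suc M. (1 / 2) ^ digit_count q w j)"
    using M by (intro sum_mono2) auto
  also have "\<dots> = (real q - 1 / 2) * (real q - 1 / 2) ^ M"
    using sum_half_power_digit_count[OF assms(1,2), of "Suc M"] by simp
  also have "(real q - 1 / 2) ^ M = (real q ^ M) powr \<alpha>"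
  proof -
    have "(real q ^ M) powr \<alpha> = (real q powr \<alpha>) powr M"
      using q by (simp add: powr_realpow[symmetric] powr_powr mult.commute)
    also have "real q powr \<alpha> = real q - 1 / 2"
      using q by (simp add: \<alpha>_def)
    finally show ?thesis using q by (simp add: powr_realpow)
  qed
  also have "(real q - 1 / 2) * (real q ^ M) powr \<alpha> \<le> real q * real N powr \<alpha>"
  proof (rule mult_mono)
    have "\<alpha> \<ge> 0" using q by (simp add: \<alpha>_def)
    then show "(real q ^ M) powr \<alpha> \<le> real N powr \<alpha>"
      using M(1) q by (intro powr_mono2) (auto simp flip: of_nat_power)
  qed (use q in auto)
  finally show ?thesis by (simp add: \<alpha>_def)
qed

text \<open>
  The average of \<open>2 ^ (- digit_count q w j)\<close> over \<open>j < N\<close> decays like a power of \<open>N\<close>. By Markov's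
  inequality one may let the required number of digits grow with \<open>j\<close>, as long as this costs less
  than that power; asking for \<open>2 ^ digit_count q w j\<close> to be at least \<open>ln (j + 1)\<close> costs only a
  logarithm.
\<close>
lemma density_one_digit_count_at_top:
  assumes "0 < w" "w < q"
  obtains J where "density_one J"
    "filterlim (digit_count q w) at_top (inf sequentially (principal J))"
proof -
  define J where "J = {j. ln (real j + 1) \<le> 2 ^ digit_count q w j}"
  define \<alpha> where "\<alpha> = log q (real q - 1 / 2)"
  have q: "real q \<ge> 2" using assms by linarith
  have \<alpha>: "\<alpha> < 1" using q by (simp add: \<alpha>_def log_less_one_cancel_iff)
  have bad: "real (card ({..<N} - J)) \<le> real q * ln (real N + 1) * real N powr \<alpha>" if "N > 0" for N
  proof -
    have "real (card ({..<N} - J)) = (\<Sum>j\<in>{..<N} - J. 1)" by simp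
    also have "\<dots> \<le> (\<Sum>j\<in>{..<N} - J. ln (real N + 1) * (1 / 2) ^ digit_count q w j)"
    proof (rule sum_mono)
      fix j assume j: "j \<in> {..<N} - J"
      then have "2 ^ digit_count q w j < ln (real j + 1)" by (simp add: J_def)
      also have "\<dots> \<le> ln (real N + 1)" using j by simp
      finally show "1 \<le> ln (real N + 1) * (1 / 2) ^ digit_count q w j"
        by (simp add: field_simps)
    qed
    also have "\<dots> \<le> (\<Sum>j<N. ln (real N + 1) * (1 / 2) ^ digit_count q w j)"
      by (rule sum_mono2) auto
    also have "\<dots> = ln (real N + 1) * (\<Sum>j<N. (1 / 2) ^ digit_count q w j)"
      by (simp add: sum_distrib_left)
    also have "\<dots> \<le> ln (real N + 1) * (real q * real N powr \<alpha>)"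
      unfolding \<alpha>_def
      by (rule mult_left_mono[OF sum_half_power_digit_count_le[OF assms that]]) simp
    finally show ?thesis by (simp add: mult_ac)
  qed
  have "((\<lambda>N. real (card ({..<N} - J)) / real N) \<longlonglongrightarrow> 0)"
  proof (rule tendsto_sandwich[where f = "\<lambda>_. 0"])
    show "(\<lambda>N::nat. real q * ln (real N + 1) * real N powr \<alpha> / real N) \<longlonglongrightarrow> 0"
      using \<alpha> by real_asymp
    show "\<forall>\<^sub>F N in sequentially. real (card ({..<N} - J)) / real N
        \<le> real q * ln (real N + 1) * real N powr \<alpha> / real N"
      using eventually_gt_at_top[of 0] by eventually_elim (intro divide_right_mono bad, auto)
    show "(\<lambda>_ :: nat. 0 :: real) \<longlonglongrightarrow> 0" by simp
    show "\<forall>\<^sub>F N in sequentially. 0 \<le> real (card ({..<N} - J)) / real N" by simp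
  qed
  then have "(\<lambda>N. 1 - real (card ({..<N} - J)) / real N) \<longlonglongrightarrow> 1 - 0"
    by (intro tendsto_intros)
  moreover have "\<forall>\<^sub>F N in sequentially. 1 - real (card ({..<N} - J)) / real N
      = real (card (J \<inter> {0..<N})) / real N"
    using eventually_gt_at_top[of 0]
  proof eventually_elim
    fix N :: nat assume "0 < N"
    have "card ({..<N} - J \<union> J \<inter> {0..<N}) = card ({..<N} - J) + card (J \<inter> {0..<N})"
      by (rule card_Un_disjoint) auto
    moreover have "{..<N} - J \<union> J \<inter> {0..<N} = {..<N}" by auto
    ultimately have "real N = real (card ({..<N} - J)) + real (card (J \<inter> {0..<N}))"
      by simp
    then show "1 - real (card ({..<N} - J)) / real N = real (card (J \<inter> {0..<N})) / real N"
      using \<open>0 < N\<close> by (simp add: field_simps)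
  qed
  ultimately have "(\<lambda>N. real (card (J \<inter> {0..<N})) / real N) \<longlonglongrightarrow> 1 - 0"
    by (rule Lim_transform_eventually)
  then have "density_one J"
    by (simp add: density_one_def)
  moreover have "filterlim (digit_count q w) at_top (inf sequentially (principal J))"
    unfolding filterlim_at_top eventually_inf_principal
  proof
    fix Z :: nat
    have "filterlim (\<lambda>j. ln (real j + 1)) at_top sequentially" by real_asymp
    then have "\<forall>\<^sub>F j in sequentially. 2 ^ Z \<le> ln (real j + 1)"
      by (simp add: filterlim_at_top)
    then show "\<forall>\<^sub>F j in sequentially. j \<in> J \<longrightarrow> Z \<le> digit_count q w j"
    proof eventually_elim
      fix j :: nat assume "2 ^ Z \<le> ln (real j + 1)"
      show "j \<in> J \<longrightarrow> Z \<le> digit_count q w j"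
      proof
        assume "j \<in> J"
        then have "(2 :: real) ^ Z \<le> 2 ^ digit_count q w j"
          using \<open>2 ^ Z \<le> _\<close> unfolding J_def mem_Collect_eq by linarith
        then show "Z \<le> digit_count q w j" using power_increasing_iff[of "2 :: real"] by simp
      qed
    qed
  qed
  ultimately show ?thesis by (rule that)
qed

section \<open>Gaps in the expansion of the exponent\<close>

text \<open>
  The base \<open>q = p ^ (2 * L + 1)\<close> and the digit \<open>w = p ^ L\<close> are chosen such that an occurrence of \<open>w\<close>
  in base \<open>q\<close> is a digit \<open>1\<close> in base \<open>p\<close> with \<open>L\<close> zeros on either side. Since \<open>p ^ L\<close> exceeds the
  diameter \<open>r\<close> of the set of exponents of \<open>P\<close>, these gaps decouple the two sides.
\<close>
context
  fixes P :: "int ^ 'd::finite \<Rightarrow>\<^sub>0 'p::prime_card mod_ring" and r L q w :: nat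
  assumes two: "2 \<le> card (keys P)" and r: "spread (int r) (keys P)" "r < CARD('p) ^ L"
    and q: "q = CARD('p) ^ (2 * L + 1)" and w: "w = CARD('p) ^ L"
begin

lemma digit_bounds: "0 < w" "w < q"
proof -
  have p: "1 < CARD('p)" using prime_gt_1_nat[OF prime_card] .
  show "0 < w" by (simp add: w)
  show "w < q" unfolding w q using p by (intro power_strict_increasing) auto
qed

lemma scale_eq: "w * q ^ n = CARD('p) ^ (L + (2 * L + 1) * n)"
  unfolding w q power_mult[symmetric] power_add[symmetric] ..

text \<open>
  An occurrence of \<open>w\<close> in the expansion of \<open>j\<close> factors the power into three parts at well separated
  scales: the digits above the occurrence, the occurrence itself, and the digits below it.
\<close>
lemma power_split:
  assumes "j = (i * q + w) * q ^ n + t"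
  shows "P ^ j = ((P ^ i) ^ (CARD('p) ^ (L + 1)) * P) ^ (w * q ^ n) * P ^ t"
proof -
  have "q = CARD('p) ^ (L + 1) * w" unfolding q w power_add[symmetric] by (simp add: mult_2)
  then have "i * q + w = (i * CARD('p) ^ (L + 1) + 1) * w" by (simp only: add_mult_distrib mult.assoc mult_1)
  then have "j = (i * CARD('p) ^ (L + 1) + 1) * (w * q ^ n) + t"
    unfolding assms by (simp only: mult.assoc)
  then show ?thesis by (simp only: power_add power_mult power_one_right)
qed

text \<open>
  The zeros above the occurrence keep the translates of \<open>P\<close> apart, and each has at least two terms.
\<close>
lemma card_keys_split:
  "2 * card (keys (P ^ i)) \<le> card (keys ((P ^ i) ^ (CARD('p) ^ (L + 1)) * P))"
proof -
  have "CARD('p) ^ L \<le> CARD('p) ^ (L + 1)" by simp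
  then have "int r < int (CARD('p) ^ (L + 1))" using r(2) by linarith
  then have "card (keys (P ^ i)) * card (keys P) \<le> card (keys ((P ^ i) ^ (CARD('p) ^ (L + 1)) * P))"
    by (rule card_keys_power_mult[OF refl r(1)])
  moreover have "2 * card (keys (P ^ i)) \<le> card (keys (P ^ i)) * card (keys P)"
    using mult_le_mono2[OF two, of "card (keys (P ^ i))"] by (simp add: mult.commute)
  ultimately show ?thesis by (rule le_trans[rotated])
qed

text \<open>
  The zeros below the occurrence: the part from the lower digits has diameter at most \<open>t * r\<close>, which
  stays at least \<open>q ^ n\<close> below the scale \<open>w * q ^ n\<close> of the part above. This slack is what separates
  the factors of a character in the end.
\<close>
lemma spread_low_part:
  assumes "t < q ^ n"
  shows "int t * int r + int (q ^ n) \<le> int (w * q ^ n)"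
proof -
  have "t * r + q ^ n \<le> q ^ n * r + q ^ n" using assms by simp
  also have "\<dots> = q ^ n * Suc r" by simp
  also have "\<dots> \<le> q ^ n * CARD('p) ^ L" using r(2) by (intro mult_le_mono) simp_all
  also have "\<dots> = w * q ^ n"
    by (simp add: w)
  finally show ?thesis by (metis of_nat_add of_nat_le_iff of_nat_mult)
qed

text \<open>
  Every occurrence of \<open>w\<close> doubles the number of terms. The digits between two occurrences may cause
  cancellation, but only within the translates, each of which remains nonzero; therefore the
  induction goes from one occurrence to the next and not from digit to digit.
\<close>
lemma two_power_digit_count_le_card_keys: "2 ^ digit_count q w j \<le> card (keys (P ^ j))"
proof (induction j rule: less_induct)
  case (less j)
  have nz: "0 < card (keys (P ^ n))" for n
  proof -
    have "P \<noteq> 0" using two by auto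
    then show ?thesis using power_nonzero[of P n] by (simp add: card_gt_0_iff)
  qed
  show ?case
  proof (cases "digit_count q w j = 0")
    case True
    then show ?thesis using nz[of j] by simp
  next
    case False
    then have "0 < digit_count q w j" by simp
    then obtain n i t where split: "t < q ^ n" "j = (i * q + w) * q ^ n + t"
      "digit_count q w j \<le> digit_count q w i + Suc 0"
      using digit_count_split[OF digit_bounds] by blast
    have "i \<le> i * q" using digit_bounds by simp
    then have "i < i * q + w" using digit_bounds by linarith
    also have "\<dots> \<le> (i * q + w) * q ^ n" using digit_bounds by simp
    finally have "i < j" using split(2) by simp
    have "2 ^ digit_count q w j \<le> (2 :: nat) ^ (digit_count q w i + 1)"
      using split(3) by (intro power_increasing) simp_all
    also have "\<dots> \<le> 2 * card (keys (P ^ i))" using less[OF \<open>i < j\<close>] by simp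
    also have "\<dots> \<le> card (keys ((P ^ i) ^ (CARD('p) ^ (L + 1)) * P)) * card (keys (P ^ t))"
      using mult_le_mono[OF card_keys_split[of i] Suc_leI[OF nz[of t]]] by simp
    also have "\<dots> \<le> card (keys (P ^ j))"
      unfolding power_split[OF split(2)]
    proof (rule card_keys_power_mult[OF scale_eq spread_keys_power[OF r(1)]])
      show "int t * int r < int (w * q ^ n)"
        using spread_low_part[OF split(1)] split(1) by linarith
    qed
    finally show ?thesis .
  qed
qed

text \<open>
  The occurrences of \<open>w\<close> at the lowest \<open>m\<close> positions are given up, because a gap must be wide
  enough for \<open>S\<close> and for the support of \<open>\<psi>\<close>. At the first occurrence from \<open>m\<close> on, the lower digits
  are absorbed into the character, and every term of the power belonging to the higher digits yields
  a separated factor.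
\<close>
lemma two_power_digit_count_le_rank:
  fixes \<psi> :: "('p, 's::finite, 'd) config \<Rightarrow> complex"
  assumes "0 < S" and \<psi>: "character \<psi>" "nontrivial \<psi>"
  obtains m where "\<And>j. m < digit_count q w j \<Longrightarrow>
    2 ^ (digit_count q w j - m) \<le> rank S (\<lambda>a. \<psi> (act (P ^ j) a))"
proof -
  obtain t where t: "spread (int t) (support \<psi>)"
    using finite_spread[OF finite_support[OF \<psi>(1)]] by blast
  define m where "m = nat \<lceil>S + real t\<rceil>"
  have "S + real t \<le> real m" unfolding m_def by linarith
  also have "m \<le> q ^ m" using digit_bounds by (intro less_imp_le power_gt_expt) simp
  finally have m: "S + real t \<le> real (q ^ m)" by simp
  have "P \<noteq> 0" using two by auto
  show ?thesis
  proof
    fix j assume "m < digit_count q w j"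
    then obtain n i u where split: "m \<le> n" "u < q ^ n" "j = (i * q + w) * q ^ n + u"
      "digit_count q w j \<le> digit_count q w i + Suc m"
      using digit_count_split[OF digit_bounds] by blast
    have "(2 :: nat) ^ (digit_count q w j - m) \<le> 2 ^ (digit_count q w i + 1)"
      using split(4) by (intro power_increasing) auto
    also have "\<dots> \<le> 2 * card (keys (P ^ i))"
      using two_power_digit_count_le_card_keys[of i] by simp
    also have "\<dots> \<le> card (keys ((P ^ i) ^ (CARD('p) ^ (L + 1)) * P))"
      by (rule card_keys_split)
    also have "\<dots> \<le> rank S (\<lambda>a. \<psi> (act (P ^ j) a))"
      unfolding power_split[OF split(3)]
    proof (rule card_keys_le_rank[OF \<open>0 < S\<close> \<psi>(1) _ _ scale_eq spread_keys_power[OF r(1)] t])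
      show "nontrivial (\<lambda>a. \<psi> (act (P ^ u) a))"
        by (rule nontrivial_comp_act_power[OF \<psi> \<open>P \<noteq> 0\<close>])
      show "(P ^ i) ^ (CARD('p) ^ (L + 1)) * P \<noteq> 0"
        using power_nonzero[OF \<open>P \<noteq> 0\<close>, of "i * CARD('p) ^ (L + 1) + 1"]
        by (simp only: power_add power_mult power_one_right not_False_eq_True)
      have "real (q ^ m) \<le> real (q ^ n)"
        using split(1) digit_bounds by (intro of_nat_mono power_increasing) auto
      moreover have "real u * real r + real (q ^ n) \<le> real (w * q ^ n)"
        using spread_low_part[OF split(2)] by (metis of_nat_add of_nat_le_iff of_nat_mult)
      ultimately show "S + real_of_int (int u * int r + int t) \<le> real (w * q ^ n)"
        using m by simp
    qed
    finally show "2 ^ (digit_count q w j - m) \<le> rank S (\<lambda>a. \<psi> (act (P ^ j) a))" .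
  qed
qed

end

lemma dispersive_if_linear_CA:
  fixes \<Phi> :: "('p::prime_card, 's::finite, 'd::finite) config \<Rightarrow> ('p, 's, 'd) config"
  assumes "linear_CA \<Phi>"
  shows "dispersive \<Phi>"
proof -
  obtain F \<phi> where F: "finite F" "2 \<le> card F" "\<forall>f\<in>F. \<not> [\<phi> f = 0] (mod int CARD('p))"
    "\<Phi> = shift_sum F \<phi>"
    using assms unfolding linear_CA_def by blast
  obtain P :: "int ^ 'd \<Rightarrow>\<^sub>0 'p mod_ring" where P: "keys P = F" "\<Phi> = act P"
    using shift_sum_eq_act[OF F(1,3)] F(4) by metis
  obtain r where r: "spread (int r) (keys P)" using finite_spread[OF finite_keys] by blast
  \<comment> \<open>Gaps of \<open>r\<close> zeros are long enough, because \<open>r < p ^ r\<close>.\<close>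
  define q w where "q = CARD('p) ^ (2 * r + 1)" and "w = CARD('p) ^ r"
  have "r < CARD('p) ^ r"
    using prime_gt_1_nat[OF prime_card[where 'a = 'p]] by (simp add: power_gt_expt)
  note ctx = F(2)[folded P(1)] r \<open>r < CARD('p) ^ r\<close> q_def w_def
  obtain J where J: "density_one J" "filterlim (digit_count q w) at_top (inf sequentially (principal J))"
    using density_one_digit_count_at_top[OF digit_bounds[OF ctx]] by blast
  have "filterlim (\<lambda>j. rank S (\<psi> \<circ> (\<Phi> ^^ j))) at_top (inf sequentially (principal J))"
    if "0 < S" and \<psi>: "character \<psi>" "nontrivial \<psi>" for S and \<psi> :: "('p, 's, 'd) config \<Rightarrow> complex"
  proof -
    obtain m where m: "\<And>j. m < digit_count q w j \<Longrightarrow>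
        2 ^ (digit_count q w j - m) \<le> rank S (\<lambda>a. \<psi> (act (P ^ j) a))"
      using two_power_digit_count_le_rank[OF ctx \<open>0 < S\<close> \<psi>] by blast
    show ?thesis
      unfolding filterlim_at_top
    proof
      fix Z
      have "\<forall>\<^sub>F j in inf sequentially (principal J). m + Suc Z \<le> digit_count q w j"
        using J(2) by (simp add: filterlim_at_top)
      then show "\<forall>\<^sub>F j in inf sequentially (principal J). Z \<le> rank S (\<psi> \<circ> (\<Phi> ^^ j))"
      proof eventually_elim
        case (elim j)
        have "Z \<le> digit_count q w j - m" using elim by simp
        also have "\<dots> \<le> 2 ^ (digit_count q w j - m)" by (simp add: less_imp_le)
        also have "\<dots> \<le> rank S (\<lambda>a. \<psi> (act (P ^ j) a))" using m elim by simp
        also have "(\<lambda>a. \<psi> (act (P ^ j) a)) = \<psi> \<circ> (\<Phi> ^^ j)"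
          unfolding P(2) act_funpow by (simp add: o_def)
        finally show ?case .
      qed
    qed
  qed
  then show ?thesis
    unfolding dispersive_def by (intro allI impI exI[of _ J] conjI J(1)) simp_all
qed

theorem theorem4p1:
  fixes \<Phi> :: "('p::prime_card, 's::finite, 'd::finite) config \<Rightarrow> ('p, 's, 'd) config"
  assumes "bipartite \<Phi>"
  shows "dispersive \<Phi>"
  by (rule dispersive_if_linear_CA, rule conjunct1, rule assms[unfolded bipartite_def])

end
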